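(* Let $\varepsilon>0$, let $n$ be an integer and let $m\leq(\frac12-\varepsilon)\ln\ln n$. Then w.h.p.\ Breaker has a strategy to isolate a vertex in Maker's graph (i.e., to claim all $n-1$ edges of $K_n$ incident to some vertex) while playing the $(m:1)$ random-Maker game on $E(K_n)$.
   Context: The $(m:1)$ random-Maker game on the board $E(K_n)$: Maker and Breaker alternately claim previously unclaimed edges of $K_n$, Breaker moving first. In each round Breaker claims one unclaimed edge of his choice (according to a strategy), and Maker claims $m$ edges chosen uniformly at random among all unclaimed edges. "W.h.p." means with probability tending to $1$ as $n\to\infty$. *)

theory Defs
  imports "HOL-Probability.Probability"
begin

definition K_edges :: "nat \<Rightarrow> nat set set" where
  "K_edges n = {e. e \<subseteq> {..<n} \<and> card e = 2}"

text \<open>A round consists of the edge claimed by Breaker and the set of edges with which Maker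
  answers. A history lists the rounds played so far, the most recent one first; a strategy of
  Breaker may depend on the whole history.\<close>

type_synonym history = "(nat set \<times> nat set set) list"
type_synonym strategy = "history \<Rightarrow> nat set"

definition breaker_edges :: "history \<Rightarrow> nat set set" where
  "breaker_edges h = fst ` set h"

definition maker_edges :: "history \<Rightarrow> nat set set" where
  "maker_edges h = \<Union> (snd ` set h)"

definition unclaimed :: "nat \<Rightarrow> history \<Rightarrow> nat set set" where
  "unclaimed n h = K_edges n - (breaker_edges h \<union> maker_edges h)"

definition breaker_strategy :: "nat \<Rightarrow> strategy \<Rightarrow> bool" where
  "breaker_strategy n S \<longleftrightarrow> (\<forall>h. unclaimed n h \<noteq> {} \<longrightarrow> S h \<in> unclaimed n h)"

text \<open>The minimum only matters in the last round: if fewer than \<open>m\<close> edges are left, Maker takes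
  all of them.\<close>

definition random_claim :: "nat \<Rightarrow> nat set set \<Rightarrow> nat set set pmf" where
  "random_claim m U = pmf_of_set {A. A \<subseteq> U \<and> card A = min m (card U)}"

definition play_round :: "nat \<Rightarrow> nat \<Rightarrow> strategy \<Rightarrow> history \<Rightarrow> history pmf" where
  "play_round n m S h =
     (if unclaimed n h = {} then return_pmf h
      else map_pmf (\<lambda>A. (S h, A) # h) (random_claim m (unclaimed n h - {S h})))"

primrec play_rounds :: "nat \<Rightarrow> nat \<Rightarrow> strategy \<Rightarrow> nat \<Rightarrow> history pmf" where
  "play_rounds n m S 0 = return_pmf []"
| "play_rounds n m S (Suc k) = bind_pmf (play_rounds n m S k) (play_round n m S)"

text \<open>Under a Breaker strategy each round claims at least one edge, so after as many rounds as
  there are edges the whole board has been claimed.\<close>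

definition random_maker_game :: "nat \<Rightarrow> nat \<Rightarrow> strategy \<Rightarrow> history pmf" where
  "random_maker_game n m S = play_rounds n m S (card (K_edges n))"

definition isolates_vertex :: "nat \<Rightarrow> history \<Rightarrow> bool" where
  "isolates_vertex n h \<longleftrightarrow> (\<exists>v<n. {e \<in> K_edges n. v \<in> e} \<subseteq> breaker_edges h)"

end

theory Submission
  imports Defs "HOL-Real_Asymp.Real_Asymp"
begin

text \<open>Breaker always plays at the least vertex that is isolated in Maker's graph, the target.
  Within the first \<open>R\<close> rounds, with \<open>R\<close> of order \<open>n ln n / (ln (ln n))\<^sup>2\<close>, almost the whole board
  is free, so a round touches a given vertex with probability at most \<open>p \<approx> 2 m / n\<close>. Two potentials
  bound the probability that Breaker has not won after \<open>R\<close> rounds.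

  With \<open>x\<close> isolated vertices, \<open>1 / (x + 1)\<close> grows in expectation by a factor of at most
  \<open>1 + (2 m + 1) p\<close> per round. It starts at \<open>1 / (n + 1)\<close> and equals \<open>1\<close> once no vertex is isolated,
  so with high probability targets do not run out.

  As long as Breaker has not won and the target has \<open>i\<close> free edges, \<open>2 - (1 - p)^i\<close> shrinks in
  expectation by a factor of at most \<open>1 - p q / 2\<close> per round, where \<open>q = (1 - p)^(n - 1)\<close> is about
  \<open>exp (- 2 m)\<close>. It lies between \<open>1\<close> and \<open>2\<close>, and the bound on \<open>m\<close> makes \<open>p q R\<close> tend to
  infinity.\<close>

section \<open>The board and Maker's uniformly random answer\<close>

lemma finite_K_edges: "finite (K_edges n)"
  unfolding K_edges_def by (rule finite_subset[of _ "Pow {..<n}"]) auto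

lemma card_K_edges: "card (K_edges n) = n choose 2"
  unfolding K_edges_def using n_subsets[of "{..<n}" 2] by simp

lemma card_incident_K_edges_le:
  assumes "v < n"
  shows "card {e \<in> K_edges n. v \<in> e} \<le> n - 1"
proof -
  have "{e \<in> K_edges n. v \<in> e} \<subseteq> (\<lambda>w. {v, w}) ` ({..<n} - {v})"
    unfolding K_edges_def by (auto simp: card_2_iff)
  hence "card {e \<in> K_edges n. v \<in> e} \<le> card ({..<n} - {v})"
    by (meson card_image_le card_mono finite_Diff finite_imageI finite_lessThan le_trans)
  thus ?thesis using assms by simp
qed

lemma finite_unclaimed: "finite (unclaimed n h)"
  unfolding unclaimed_def using finite_K_edges by auto

lemma unclaimed_Cons: "unclaimed n ((e, A) # h) = unclaimed n h - {e} - A"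
  unfolding unclaimed_def breaker_edges_def maker_edges_def by auto

lemma set_pmf_random_claim:
  assumes "finite U"
  shows "set_pmf (random_claim m U) = {A. A \<subseteq> U \<and> card A = min m (card U)}"
  unfolding random_claim_def
proof (rule set_pmf_of_set)
  show "{A. A \<subseteq> U \<and> card A = min m (card U)} \<noteq> {}"
    using obtain_subset_with_card_n[of "min m (card U)" U] by auto
  show "finite {A. A \<subseteq> U \<and> card A = min m (card U)}"
    using assms by (auto intro: finite_subset[of _ "Pow U"])
qed

lemma finite_set_pmf_random_claim: "finite U \<Longrightarrow> finite (set_pmf (random_claim m U))"
  by (auto simp: set_pmf_random_claim intro: finite_subset[of _ "Pow U"])

text \<open>By symmetry a uniform \<open>k\<close>-subset of \<open>U\<close> contains
  \<open>e\<close> with probability \<open>k / card U\<close>. The proof counts with the absorption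
  identity for binomial coefficients and uses \<open>k \<le> m\<close>.\<close>

lemma prob_random_claim_mem_le:
  assumes U: "finite U" and e: "e \<in> U"
  shows "measure_pmf.prob (random_claim m U) {A. e \<in> A} \<le> real m / real (card U)"
proof -
  define k where "k = min m (card U)"
  let ?F = "{A. A \<subseteq> U \<and> card A = k}"
  have c0: "card U > 0" using U e card_gt_0_iff by blast
  have fin: "finite ?F" using U by (auto intro: finite_subset[of _ "Pow U"])
  have ne: "?F \<noteq> {}"
    using obtain_subset_with_card_n[of k U] unfolding k_def by auto
  have prob: "measure_pmf.prob (random_claim m U) {A. e \<in> A}
      = real (card (?F \<inter> {A. e \<in> A})) / real (card ?F)"
    unfolding random_claim_def k_def[symmetric] by (rule measure_pmf_of_set[OF ne fin])
  show ?thesis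
  \<comment> \<open>The case \<open>k = 0\<close> is separated because \<open>k - 1\<close> is
    truncated subtraction.\<close>
  proof (cases "k = 0")
    case True
    have "?F \<inter> {A. e \<in> A} = {}" using True U by (auto dest: finite_subset)
    thus ?thesis unfolding prob by simp
  next
    case False
    have "?F \<inter> {A. e \<in> A} \<subseteq> insert e ` {B. B \<subseteq> U - {e} \<and> card B = k - 1}"
    proof
      fix A assume A: "A \<in> ?F \<inter> {A. e \<in> A}"
      hence "A = insert e (A - {e})" "A - {e} \<subseteq> U - {e}" "card (A - {e}) = k - 1"
        by (auto simp: card_Diff_singleton)
      thus "A \<in> insert e ` {B. B \<subseteq> U - {e} \<and> card B = k - 1}" by blast
    qed
    hence "card (?F \<inter> {A. e \<in> A}) \<le> card {B. B \<subseteq> U - {e} \<and> card B = k - 1}"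
      using U by (intro surj_card_le) (auto intro: finite_subset[of _ "Pow U"])
    also have "\<dots> = (card U - 1) choose (k - 1)"
      using n_subsets[of "U - {e}" "k - 1"] U e by simp
    finally have "card U * card (?F \<inter> {A. e \<in> A}) \<le> card U * ((card U - 1) choose (k - 1))"
      by simp
    also have "\<dots> = k * (card U choose k)"
      using times_binomial_minus1_eq[of k "card U"] False by simp
    also have "\<dots> = k * card ?F" using n_subsets[OF U, of k] by simp
    also have "\<dots> \<le> m * card ?F" unfolding k_def by simp
    finally have le: "real (card U) * real (card (?F \<inter> {A. e \<in> A})) \<le> real m * real (card ?F)"
      by (simp only: of_nat_mult[symmetric] of_nat_le_iff)
    have frac: "x / f \<le> a / u" if "u * x \<le> a * f" "0 < f" "0 < u" for x f a u :: real
      using that by (simp add: field_simps)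
    have "card ?F > 0" unfolding card_gt_0_iff by (rule conjI[OF ne fin])
    hence "0 < real (card ?F)" "0 < real (card U)" using c0 by (simp_all only: of_nat_0_less_iff)
    thus ?thesis unfolding prob by (rule frac[OF le])
  qed
qed

text \<open>Union bound over the edges at \<open>v\<close> that are still available.\<close>

lemma prob_random_claim_hits_vertex_le:
  assumes U: "U \<subseteq> K_edges n" and v: "v < n"
  shows "measure_pmf.prob (random_claim m U) {A. v \<in> \<Union>A} \<le> real (n - 1) * (real m / real (card U))"
proof -
  have fU: "finite U" using U finite_K_edges finite_subset by blast
  let ?E = "{e \<in> U. v \<in> e}"
  have "measure_pmf.prob (random_claim m U) {A. v \<in> \<Union>A}
      \<le> measure_pmf.prob (random_claim m U) (\<Union>e\<in>?E. {A. e \<in> A})"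
    by (rule measure_pmf.finite_measure_mono_AE)
       (auto simp: AE_measure_pmf_iff set_pmf_random_claim[OF fU])
  also have "\<dots> \<le> (\<Sum>e\<in>?E. measure_pmf.prob (random_claim m U) {A. e \<in> A})"
    using fU by (intro measure_pmf.finite_measure_subadditive_finite) auto
  also have "\<dots> \<le> (\<Sum>e\<in>?E. real m / real (card U))"
    by (intro sum_mono prob_random_claim_mem_le[OF fU]) auto
  also have "\<dots> = real (card ?E) * (real m / real (card U))" by simp
  also have "\<dots> \<le> real (n - 1) * (real m / real (card U))"
  proof (intro mult_right_mono)
    have "card ?E \<le> card {e \<in> K_edges n. v \<in> e}"
      using U finite_K_edges by (intro card_mono) auto
    thus "real (card ?E) \<le> real (n - 1)" using card_incident_K_edges_le[OF v] by linarith
  qed simp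
  finally show ?thesis .
qed

section \<open>Drift inequalities along the rounds of a game\<close>

lemma finite_set_pmf_play_round: "finite (set_pmf (play_round n m S h))"
  unfolding play_round_def using finite_set_pmf_random_claim[of "unclaimed n h - {S h}" m]
    finite_unclaimed[of n h] by auto

lemma finite_set_pmf_play_rounds: "finite (set_pmf (play_rounds n m S k))"
  by (induction k) (auto simp: finite_set_pmf_play_round)

text \<open>A round uses up at most \<open>m + 1\<close> edges. This keeps the board nearly full
  early on, hence the hit probabilities small.\<close>

lemma card_unclaimed_play_rounds:
  assumes "h \<in> set_pmf (play_rounds n m S k)"
  shows "card (K_edges n) \<le> card (unclaimed n h) + (m + 1) * k"
  using assms
proof (induction k arbitrary: h)
  case 0
  thus ?case by (simp add: unclaimed_def breaker_edges_def maker_edges_def)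
next
  case (Suc k)
  then obtain h0 where h0: "h0 \<in> set_pmf (play_rounds n m S k)"
    and h: "h \<in> set_pmf (play_round n m S h0)" by auto
  have "card (unclaimed n h0) \<le> card (unclaimed n h) + (m + 1)"
  proof (cases "unclaimed n h0 = {}")
    case False
    then obtain A where A: "A \<in> set_pmf (random_claim m (unclaimed n h0 - {S h0}))"
      and hA: "h = (S h0, A) # h0" using h by (auto simp: play_round_def)
    have cA: "A \<subseteq> unclaimed n h0" "card A \<le> m"
      using A finite_unclaimed[of n h0] by (auto simp: set_pmf_random_claim)
    hence fA: "finite A" using finite_unclaimed finite_subset by blast
    have "card (unclaimed n h0) \<le> card (unclaimed n h \<union> insert (S h0) A)"
      using fA finite_unclaimed by (intro card_mono) (auto simp: hA unclaimed_Cons)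
    also have "\<dots> \<le> card (unclaimed n h) + card (insert (S h0) A)" by (rule card_Un_le)
    also have "card (insert (S h0) A) \<le> m + 1" using cA fA card_insert_le_m1[of "m+1" A "S h0"] by simp
    finally show ?thesis by simp
  qed auto
  with Suc.IH[OF h0] show ?case by simp
qed

lemma expectation_mono_pmf:
  fixes f g :: "'a \<Rightarrow> real"
  assumes "finite (set_pmf p)" "\<And>x. x \<in> set_pmf p \<Longrightarrow> f x \<le> g x"
  shows "measure_pmf.expectation p f \<le> measure_pmf.expectation p g"
  using assms
  by (intro integral_mono_AE integrable_measure_pmf_finite) (auto simp: AE_measure_pmf_iff)

lemma expectation_bind_pmf_le:
  fixes g :: "'a \<Rightarrow> real"
  assumes "finite (set_pmf p)" "\<And>x. finite (set_pmf (f x))"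
    and step: "\<And>x. x \<in> set_pmf p \<Longrightarrow> measure_pmf.expectation (f x) g \<le> c * g x"
  shows "measure_pmf.expectation (bind_pmf p f) g \<le> c * measure_pmf.expectation p g"
proof -
  have "measure_pmf.expectation (bind_pmf p f) g
      = (\<Sum>a\<in>set_pmf p. pmf p a *\<^sub>R measure_pmf.expectation (f a) g)"
    by (rule pmf_expectation_bind) (use assms in auto)
  also have "\<dots> \<le> (\<Sum>a\<in>set_pmf p. pmf p a *\<^sub>R (c * g a))"
    by (intro sum_mono scaleR_left_mono step) auto
  also have "\<dots> = c * (\<Sum>a\<in>set_pmf p. pmf p a *\<^sub>R g a)"
    by (simp add: sum_distrib_left algebra_simps)
  also have "(\<Sum>a\<in>set_pmf p. pmf p a *\<^sub>R g a) = measure_pmf.expectation p g"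
    using integral_measure_pmf[of "set_pmf p" p g] assms(1) by simp
  finally show ?thesis .
qed

text \<open>Iterates the one-step drift of a potential. The drift is asked only at reachable
  histories of the first \<open>R\<close> rounds, since later the board may be too small for
  it.\<close>

lemma expectation_play_rounds_le:
  fixes g :: "history \<Rightarrow> real"
  assumes "c \<ge> 0"
    and "\<And>k h. k < R \<Longrightarrow> h \<in> set_pmf (play_rounds n m S k) \<Longrightarrow>
           measure_pmf.expectation (play_round n m S h) g \<le> c * g h"
  shows "measure_pmf.expectation (play_rounds n m S R) g \<le> c ^ R * g []"
  using assms(2)
proof (induction R)
  case (Suc R)
  have "measure_pmf.expectation (play_rounds n m S (Suc R)) g
      \<le> c * measure_pmf.expectation (play_rounds n m S R) g"
    unfolding play_rounds.simps
    by (rule expectation_bind_pmf_le)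
       (use Suc.prems[of R] finite_set_pmf_play_round finite_set_pmf_play_rounds in auto)
  also have "\<dots> \<le> c * (c ^ R * g [])"
    by (intro mult_left_mono Suc.IH Suc.prems assms(1) less_SucI)
  finally show ?case by (simp add: mult.assoc)
qed simp

lemma isolates_vertex_Cons: "isolates_vertex n h \<Longrightarrow> isolates_vertex n (x # h)"
  unfolding isolates_vertex_def breaker_edges_def by (auto simp: subset_insertI2)

lemma isolates_vertex_play_round:
  assumes "isolates_vertex n h" "h' \<in> set_pmf (play_round n m S h)"
  shows "isolates_vertex n h'"
  using assms by (auto simp: play_round_def isolates_vertex_Cons split: if_splits)

text \<open>A win of Breaker is permanent, so the indicator of not having won never increases. An
  analysis of the first rounds thereby bounds the failure probability of the whole game.\<close>

lemma prob_not_isolates_vertex_antimono: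
  assumes "k \<le> l"
  shows "measure_pmf.prob (play_rounds n m S k) {h. \<not> isolates_vertex n h}
       \<ge> measure_pmf.prob (play_rounds n m S l) {h. \<not> isolates_vertex n h}"
  using assms
proof (induction l rule: dec_induct)
  case (step l)
  let ?g = "indicat_real {h. \<not> isolates_vertex n h}"
  have "measure_pmf.expectation (play_rounds n m S (Suc l)) ?g
      \<le> 1 * measure_pmf.expectation (play_rounds n m S l) ?g"
    unfolding play_rounds.simps
  proof (rule expectation_bind_pmf_le)
    fix h
    have "measure_pmf.expectation (play_round n m S h) ?g
        \<le> measure_pmf.expectation (play_round n m S h) (\<lambda>_. ?g h)"
      by (rule expectation_mono_pmf[OF finite_set_pmf_play_round])
         (auto simp: indicator_def dest: isolates_vertex_play_round)
    thus "measure_pmf.expectation (play_round n m S h) ?g \<le> 1 * ?g h" by simp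
  qed (auto simp: finite_set_pmf_play_round finite_set_pmf_play_rounds)
  with step.IH show ?case by simp
qed simp

section \<open>Breaker's strategy of chasing one isolated vertex\<close>

definition isolated :: "nat \<Rightarrow> history \<Rightarrow> nat set" where
  "isolated n h = {v. v < n \<and> v \<notin> \<Union>(maker_edges h)}"

text \<open>The minimum is a choice that needs no memory: the set of isolated vertices only shrinks,
  so its minimum stays the same until Maker touches it.\<close>

definition target :: "nat \<Rightarrow> history \<Rightarrow> nat" where
  "target n h = Min (isolated n h)"

definition free_at :: "nat \<Rightarrow> history \<Rightarrow> nat \<Rightarrow> nat set set" where
  "free_at n h v = {e \<in> unclaimed n h. v \<in> e}"

text \<open>The last branch makes the move legal at every history, also where there is nothing to
  chase.\<close>

definition target_strategy :: "nat \<Rightarrow> strategy" where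
  "target_strategy n h =
     (if isolated n h \<noteq> {} \<and> free_at n h (target n h) \<noteq> {}
      then SOME e. e \<in> free_at n h (target n h) else SOME e. e \<in> unclaimed n h)"

lemma target_strategy_free_at:
  assumes "isolated n h \<noteq> {}" "free_at n h (target n h) \<noteq> {}"
  shows "target_strategy n h \<in> free_at n h (target n h)"
  using assms unfolding target_strategy_def by (auto intro: someI)

lemma breaker_strategy_target_strategy: "breaker_strategy n (target_strategy n)"
  unfolding breaker_strategy_def
proof (intro allI impI)
  fix h assume ne: "unclaimed n h \<noteq> {}"
  show "target_strategy n h \<in> unclaimed n h"
  proof (cases "isolated n h \<noteq> {} \<and> free_at n h (target n h) \<noteq> {}")
    case True
    thus ?thesis using target_strategy_free_at[of n h] by (auto simp: free_at_def)
  next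
    case False
    thus ?thesis using ne unfolding target_strategy_def by (auto intro: someI)
  qed
qed

lemma finite_isolated: "finite (isolated n h)"
  unfolding isolated_def by simp

lemma isolated_Cons: "isolated n ((e, A) # h) = isolated n h - \<Union>A"
  unfolding isolated_def maker_edges_def by auto

lemma isolated_Nil: "isolated n [] = {..<n}"
  unfolding isolated_def maker_edges_def by auto

lemma target_in_isolated: "isolated n h \<noteq> {} \<Longrightarrow> target n h \<in> isolated n h"
  unfolding target_def using finite_isolated by (rule Min_in)

lemma target_Cons:
  assumes "isolated n h \<noteq> {}" "target n h \<notin> \<Union>A"
  shows "target n ((e, A) # h) = target n h"
proof -
  have 1: "target n h \<in> isolated n h - \<Union>A" using target_in_isolated assms by blast
  show "target n ((e, A) # h) = target n h"
    unfolding target_def[of n "(e, A) # h"] isolated_Cons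
    using 1 by (intro Min_eqI) (auto simp: target_def finite_isolated)
qed

text \<open>Maker owns no edge at \<open>v\<close>, so if none were free, all of them would be
  Breaker's. Hence the chase cannot stall before a win.\<close>

lemma free_at_nonempty:
  assumes "\<not> isolates_vertex n h" "v \<in> isolated n h"
  shows "free_at n h v \<noteq> {}"
  using assms unfolding isolates_vertex_def isolated_def free_at_def unclaimed_def by blast

lemma card_free_at_le: "v < n \<Longrightarrow> card (free_at n h v) \<le> n - 1"
  using card_mono[of "{e \<in> K_edges n. v \<in> e}" "free_at n h v"] finite_K_edges[of n]
    card_incident_K_edges_le[of v n]
  by (force simp: free_at_def unclaimed_def)

section \<open>The two potentials and their drift\<close>

definition scarcity :: "nat \<Rightarrow> history \<Rightarrow> real" where
  "scarcity n h = 1 / (real (card (isolated n h)) + 1)"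

text \<open>The power of \<open>1 - p\<close> stands for the chance that the target survives until
  all its free edges are Breaker's. The value \<open>0\<close> marks the two absorbing situations, a
  win and the absence of targets.\<close>

definition stakes :: "nat \<Rightarrow> real \<Rightarrow> history \<Rightarrow> real" where
  "stakes n p h = (if isolates_vertex n h \<or> isolated n h = {} then 0
     else 2 - (1 - p) ^ card (free_at n h (target n h)))"

lemma scarcity_nonneg: "scarcity n h \<ge> 0"
  unfolding scarcity_def by simp

lemma stakes_nonneg:
  assumes "0 \<le> p" "p \<le> 1"
  shows "stakes n p h \<ge> 0"
proof -
  have "(1 - p) ^ k \<le> 1" for k using assms by (intro power_le_one) auto
  from this[of "card (free_at n h (target n h))"] show ?thesis unfolding stakes_def by simp
qed

lemma stakes_le:
  assumes "0 \<le> p" "p \<le> 1"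
  shows "stakes n p h \<le> 2 - (1 - p) ^ (n - 1)"
proof -
  have a: "(1 - p) ^ (n - 1) \<le> 1" using assms by (intro power_le_one) auto
  show ?thesis
  proof (cases "isolates_vertex n h \<or> isolated n h = {}")
    case True
    thus ?thesis using a by (simp add: stakes_def)
  next
    case False
    hence "target n h < n" using target_in_isolated[of n h] by (auto simp: isolated_def)
    hence "(1 - p) ^ (n - 1) \<le> (1 - p) ^ card (free_at n h (target n h))"
      using assms card_free_at_le by (intro power_decreasing) auto
    thus ?thesis using False by (simp add: stakes_def)
  qed
qed

text \<open>Without a win, either the targets have run out and \<open>scarcity\<close> is
  \<open>1\<close>, or a chase is under way and \<open>stakes\<close> is at least
  \<open>1\<close>.\<close>

lemma lost_le_scarcity_plus_stakes:
  assumes "0 \<le> p" "p \<le> 1" "\<not> isolates_vertex n h"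
  shows "1 \<le> scarcity n h + stakes n p h"
proof (cases "isolated n h = {}")
  case True
  thus ?thesis using stakes_nonneg[of p n h] assms by (simp add: scarcity_def)
next
  case False
  have "(1 - p) ^ card (free_at n h (target n h)) \<le> 1" using assms by (intro power_le_one) auto
  thus ?thesis using False assms scarcity_nonneg[of n h] by (simp add: stakes_def)
qed

lemma expectation_play_round:
  fixes g :: "history \<Rightarrow> real"
  assumes "unclaimed n h \<noteq> {}"
  shows "measure_pmf.expectation (play_round n m S h) g
    = measure_pmf.expectation (random_claim m (unclaimed n h - {S h})) (\<lambda>A. g ((S h, A) # h))"
  using assms by (simp add: play_round_def)

lemma expectation_scarcity_play_round_le:
  assumes ne: "unclaimed n h \<noteq> {}"
    and hit: "\<And>v. v < n \<Longrightarrow> measure_pmf.prob (random_claim m (unclaimed n h - {S h})) {A. v \<in> \<Union>A} \<le> p"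
  shows "measure_pmf.expectation (play_round n m S h) (scarcity n)
    \<le> (1 + (2 * real m + 1) * p) * scarcity n h"
proof -
  let ?U = "unclaimed n h - {S h}"
  let ?P = "random_claim m ?U"
  let ?I = "isolated n h"
  define x where "x = real (card ?I)"
  have fin: "finite (set_pmf ?P)" using finite_unclaimed finite_set_pmf_random_claim by blast
  \<comment> \<open>The bound is affine in the number of isolated vertices that Maker hits. By
    linearity of expectation, hit probabilities of single vertices then suffice.\<close>
  have pointwise: "scarcity n ((S h, A) # h)
      \<le> 1 / (x + 1) + (2 * real m + 1) / (x + 1)\<^sup>2 * (\<Sum>v\<in>?I. indicator {A. v \<in> \<Union>A} A)"
    if "A \<in> set_pmf ?P" for A
  proof -
    have A: "A \<subseteq> ?U" "card A \<le> m" using that finite_unclaimed[of n h]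
      by (auto simp: set_pmf_random_claim)
    define d where "d = card (?I \<inter> \<Union>A)"
    define y where "y = card (?I - \<Union>A)"
    have x: "x = real y + real d" unfolding x_def d_def y_def
      using card_Int_Diff[OF finite_isolated, of n h "\<Union>A"] by simp
    have fA: "finite A" using A finite_unclaimed[of n h] by (auto intro: finite_subset)
    have A2: "card e = 2" "finite e" if "e \<in> A" for e
      using that A by (auto simp: unclaimed_def K_edges_def intro: finite_subset)
    \<comment> \<open>Maker's edges have two endpoints each, so at most \<open>2 m\<close> isolated
      vertices are lost.\<close>
    have "d \<le> card (\<Union>A)" unfolding d_def using fA A2 by (intro card_mono) auto
    also have "\<dots> \<le> (\<Sum>e\<in>A. card e)" by (rule card_Union_le_sum_card)
    also have "\<dots> = 2 * card A" using A2 by simp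
    finally have d: "real d \<le> 2 * real m" using A by linarith
    have "(\<Sum>v\<in>?I. indicat_real {A. v \<in> \<Union>A} A) = (\<Sum>v\<in>?I. indicator (\<Union>A) v)"
      by (simp add: indicator_def)
    also have "\<dots> = real d"
      unfolding d_def by (simp add: indicator_def finite_isolated Int_def)
    finally have s: "(\<Sum>v\<in>?I. indicat_real {A. v \<in> \<Union>A} A) = real d" .
    have "x + 1 \<le> (2 * real m + 1) * (real y + 1)"
      using d mult_nonneg_nonneg[of "2 * real m" "real y"] unfolding x distrib_left distrib_right
      by linarith
    hence "1 / (real y + 1) \<le> (2 * real m + 1) / (x + 1)"
      by (simp add: field_simps x)
    hence "real d / (x + 1) * (1 / (real y + 1)) \<le> real d / (x + 1) * ((2 * real m + 1) / (x + 1))"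
      by (rule mult_left_mono) (simp add: x)
    \<comment> \<open>The exact increment, to whose last factor the bound just shown
      applies.\<close>
    moreover have "1 / (real y + 1) = 1 / (x + 1) + real d / (x + 1) * (1 / (real y + 1))"
      by (simp add: x divide_simps)
    moreover have "scarcity n ((S h, A) # h) = 1 / (real y + 1)"
      unfolding scarcity_def isolated_Cons y_def ..
    ultimately show ?thesis unfolding s by (simp add: power2_eq_square mult.commute)
  qed
  have "measure_pmf.expectation (play_round n m S h) (scarcity n)
    \<le> measure_pmf.expectation ?P (\<lambda>A. 1 / (x + 1) + (2 * real m + 1) / (x + 1)\<^sup>2 * (\<Sum>v\<in>?I. indicator {A. v \<in> \<Union>A} A))"
    unfolding expectation_play_round[OF ne] by (rule expectation_mono_pmf[OF fin pointwise])
  also have "\<dots> = 1 / (x + 1) + (2 * real m + 1) / (x + 1)\<^sup>2 *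
      (\<Sum>v\<in>?I. measure_pmf.prob ?P {A. v \<in> \<Union>A})"
    using fin by (simp add: integrable_measure_pmf_finite Bochner_Integration.integral_sum)
  also have "\<dots> \<le> 1 / (x + 1) + (2 * real m + 1) / (x + 1)\<^sup>2 * (\<Sum>v\<in>?I. p)"
    by (intro add_left_mono mult_left_mono sum_mono hit) (auto simp: isolated_def x_def)
  also have "\<dots> = 1 / (x + 1) + (2 * real m + 1) / (x + 1)\<^sup>2 * (x * p)"
    unfolding x_def by simp
  also have "\<dots> \<le> 1 / (x + 1) + (2 * real m + 1) / (x + 1)\<^sup>2 * ((x + 1) * p)"
  proof (cases "n = 0")
    case True
    with ne have False by (auto simp: unclaimed_def K_edges_def)
    thus ?thesis ..
  next
    case False
    \<comment> \<open>Nonnegativity of \<open>p\<close> comes from the hit probability of some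
      vertex, here \<open>0\<close>.\<close>
    hence "0 \<le> p" using hit[of 0] measure_nonneg[of "measure_pmf ?P" "{A. 0 \<in> \<Union>A}"] by linarith
    thus ?thesis by (intro add_left_mono mult_left_mono mult_right_mono) (auto simp: x_def)
  qed
  also have "\<dots> = (1 + (2 * real m + 1) * p) * scarcity n h"
  proof -
    have "x + 1 \<noteq> 0" unfolding x_def by linarith
    thus ?thesis unfolding scarcity_def x_def[symmetric]
      by (simp add: power2_eq_square divide_simps)
  qed
  finally show ?thesis .
qed

text \<open>If the target survives, it has lost a free edge to Breaker. If it is hit, the next
  target has at most \<open>n - 1\<close> free edges, so the potential is at most
  \<open>2 - q\<close>. Averaging with weight \<open>p\<close> on the second case leaves a gain of
  \<open>p * q\<close>.\<close>

lemma expectation_stakes_play_round_le: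
  assumes p: "0 \<le> p" "p \<le> 1"
    and hit: "\<And>v. v < n \<Longrightarrow>
      measure_pmf.prob (random_claim m (unclaimed n h - {target_strategy n h})) {A. v \<in> \<Union>A} \<le> p"
  shows "measure_pmf.expectation (play_round n m (target_strategy n) h) (stakes n p)
    \<le> (1 - p * (1 - p) ^ (n - 1) / 2) * stakes n p h"
proof (cases "isolates_vertex n h \<or> isolated n h = {}")
  case True
  have "measure_pmf.expectation (play_round n m (target_strategy n) h) (stakes n p)
    \<le> measure_pmf.expectation (play_round n m (target_strategy n) h) (\<lambda>_. 0)"
  proof (rule expectation_mono_pmf[OF finite_set_pmf_play_round])
    fix h' assume h': "h' \<in> set_pmf (play_round n m (target_strategy n) h)"
    have "isolates_vertex n h' \<or> isolated n h' = {}"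
      using True
    proof
      assume "isolated n h = {}"
      with h' show ?thesis by (auto simp: play_round_def isolated_Cons split: if_splits)
    qed (use h' isolates_vertex_play_round in blast)
    thus "stakes n p h' \<le> 0" by (simp add: stakes_def)
  qed
  thus ?thesis using True by (simp add: stakes_def)
next
  case False
  define v where "v = target n h"
  define e where "e = target_strategy n h"
  define i where "i = card (free_at n h v)"
  define q where "q = (1 - p) ^ (n - 1)"
  \<comment> \<open>Bound for the potential after a round in which the target survives.\<close>
  define u where "u = 2 - (1 - p) ^ (i - 1)"
  let ?P = "random_claim m (unclaimed n h - {e})"
  have v: "v \<in> isolated n h" "v < n"
    unfolding v_def using target_in_isolated[of n h] False by (auto simp: isolated_def)
  have free: "free_at n h v \<noteq> {}" using free_at_nonempty v False by blast
  hence e: "e \<in> free_at n h v" unfolding e_def v_def using target_strategy_free_at False by blast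
  have ne: "unclaimed n h \<noteq> {}" using e by (auto simp: free_at_def)
  have ffree: "finite (free_at n h v)" unfolding free_at_def using finite_unclaimed by auto
  have i: "0 < i" "i \<le> n - 1"
    unfolding i_def using free ffree card_free_at_le[OF v(2)] by (auto simp: card_gt_0_iff)
  have fin: "finite (set_pmf ?P)" using finite_unclaimed finite_set_pmf_random_claim by blast
  have q: "0 \<le> q" "q \<le> (1 - p) ^ (i - 1)"
    unfolding q_def using p i by (auto intro!: power_decreasing)
  have pointwise: "stakes n p ((e, A) # h) \<le> u + (2 - q - u) * indicator {A. v \<in> \<Union>A} A" for A
  proof (cases "v \<in> \<Union>A")
    case True
    thus ?thesis using stakes_le[OF p, of n "(e, A) # h"] by (simp add: q_def)
  next
    case vA: False
    have t: "target n ((e, A) # h) = v" using target_Cons[of n h A e] vA False v_def by simp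
    have "free_at n ((e, A) # h) v \<subseteq> free_at n h v - {e}"
      by (auto simp: free_at_def unclaimed_Cons)
    hence "card (free_at n ((e, A) # h) v) \<le> card (free_at n h v - {e})"
      using ffree by (intro card_mono) auto
    also have "\<dots> = i - 1" unfolding i_def using e ffree by simp
    finally have "(1 - p) ^ (i - 1) \<le> (1 - p) ^ card (free_at n ((e, A) # h) v)"
      using p by (intro power_decreasing) auto
    moreover have "(1 - p) ^ (i - 1) \<le> 1" using p by (intro power_le_one) auto
    ultimately have "stakes n p ((e, A) # h) \<le> u" by (auto simp: stakes_def t u_def)
    thus ?thesis using vA by simp
  qed
  have "measure_pmf.expectation (play_round n m (target_strategy n) h) (stakes n p)
    \<le> measure_pmf.expectation ?P (\<lambda>A. u + (2 - q - u) * indicator {A. v \<in> \<Union>A} A)"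
    unfolding expectation_play_round[OF ne] e_def[symmetric]
    by (rule expectation_mono_pmf[OF fin pointwise])
  also have "\<dots> = u + (2 - q - u) * measure_pmf.prob ?P {A. v \<in> \<Union>A}"
    using fin by (simp add: integrable_measure_pmf_finite)
  also have "\<dots> \<le> u + (2 - q - u) * p"
    using hit[OF v(2)] q by (intro add_left_mono mult_left_mono) (auto simp: e_def u_def)
  also have "\<dots> = 2 - (1 - p) * (1 - p) ^ (i - 1) - p * q"
    unfolding u_def by (simp add: algebra_simps)
  also have "(1 - p) * (1 - p) ^ (i - 1) = (1 - p) ^ i" using i by (cases i) auto
  \<comment> \<open>The potential is at most \<open>2\<close>, so the additive gain
    \<open>p * q\<close> is at least the fraction \<open>p * q / 2\<close> of it.\<close>
  also have "2 - (1 - p) ^ i - p * q \<le> (1 - p * q / 2) * (2 - (1 - p) ^ i)"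
    using p q by (simp add: algebra_simps)
  also have "2 - (1 - p) ^ i = stakes n p h" using False by (simp add: stakes_def i_def v_def)
  finally show ?thesis unfolding q_def .
qed

text \<open>The potentials together dominate the indicator of failure after \<open>R\<close> rounds.
  Condition \<open>hazard\<close> makes \<open>p\<close> a bound for the hit probabilities even when
  \<open>R\<close> rounds' worth of edges is gone.\<close>

lemma prob_target_strategy_fails_le:
  assumes p: "0 \<le> p" "p \<le> 1"
    and R: "(m + 1) * R < n choose 2"
    and hazard: "real (n - 1) * real m \<le> p * (real (n choose 2) - real ((m + 1) * R))"
  shows "measure_pmf.prob (random_maker_game n m (target_strategy n)) {h. \<not> isolates_vertex n h}
    \<le> (1 + (2 * real m + 1) * p) ^ R / (real n + 1) + 2 * (1 - p * (1 - p) ^ (n - 1) / 2) ^ R"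
proof -
  let ?S = "target_strategy n"
  let ?G = "play_rounds n m ?S R"
  let ?q = "(1 - p) ^ (n - 1)"
  have key: "unclaimed n h \<noteq> {}"
    "\<And>v. v < n \<Longrightarrow> measure_pmf.prob (random_claim m (unclaimed n h - {?S h})) {A. v \<in> \<Union>A} \<le> p"
    if k: "k < R" and h: "h \<in> set_pmf (play_rounds n m ?S k)" for k h
  proof -
    have "(m + 1) * Suc k \<le> (m + 1) * R" using k by (intro mult_left_mono) auto
    \<comment> \<open>Since \<open>k < R\<close>, one round's worth of edges is in reserve. It pays
      for Breaker's own edge, which is removed before Maker draws.\<close>
    hence big: "n choose 2 \<le> card (unclaimed n h) + (m + 1) * R - (m + 1)"
      using card_unclaimed_play_rounds[OF h] by (simp add: card_K_edges)
    have mR: "m + 1 \<le> (m + 1) * R" using k mult_le_mono2[of 1 R "m + 1"] by simp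
    hence "card (unclaimed n h) > 1"
      using big R by linarith
    thus ne: "unclaimed n h \<noteq> {}" by auto
    define U where "U = unclaimed n h - {?S h}"
    have "?S h \<in> unclaimed n h" using breaker_strategy_target_strategy ne
      by (auto simp: breaker_strategy_def)
    hence "card U = card (unclaimed n h) - 1" unfolding U_def using finite_unclaimed by simp
    hence cU: "n choose 2 \<le> card U + (m + 1) * R" using big mR R by linarith
    hence cU0: "0 < card U" using R by linarith
    fix v assume v: "v < n"
    have "U \<subseteq> K_edges n" unfolding U_def unclaimed_def by auto
    hence "measure_pmf.prob (random_claim m U) {A. v \<in> \<Union>A} \<le> real (n - 1) * real m / real (card U)"
      using prob_random_claim_hits_vertex_le[of U n v m] v by simp
    also have "\<dots> \<le> p * real (card U) / real (card U)"
    proof (rule divide_right_mono)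
      have "real (n choose 2) - real ((m + 1) * R) \<le> real (card U)" using cU by linarith
      hence "p * (real (n choose 2) - real ((m + 1) * R)) \<le> p * real (card U)"
        using p by (intro mult_left_mono)
      thus "real (n - 1) * real m \<le> p * real (card U)" using hazard by linarith
    qed simp
    also have "\<dots> = p" using cU0 by simp
    finally show "measure_pmf.prob (random_claim m (unclaimed n h - {?S h})) {A. v \<in> \<Union>A} \<le> p"
      unfolding U_def .
  qed
  have "p * ?q \<le> 1" using p by (intro mult_le_one power_le_one) auto
  hence pq: "0 \<le> 1 - p * ?q / 2" by simp
  have sc: "measure_pmf.expectation ?G (scarcity n) \<le> (1 + (2 * real m + 1) * p) ^ R * scarcity n []"
    using p by (intro expectation_play_rounds_le expectation_scarcity_play_round_le key) auto
  have st: "measure_pmf.expectation ?G (stakes n p) \<le> (1 - p * ?q / 2) ^ R * stakes n p []"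
    using p pq by (intro expectation_play_rounds_le expectation_stakes_play_round_le key) auto
  have fin: "finite (set_pmf ?G)" by (rule finite_set_pmf_play_rounds)
  have "1 * R \<le> (m + 1) * R" by (intro mult_right_mono) auto
  hence "R \<le> card (K_edges n)" using R by (simp add: card_K_edges)
  hence "measure_pmf.prob (random_maker_game n m ?S) {h. \<not> isolates_vertex n h}
      \<le> measure_pmf.prob ?G {h. \<not> isolates_vertex n h}"
    unfolding random_maker_game_def by (rule prob_not_isolates_vertex_antimono)
  also have "\<dots> = measure_pmf.expectation ?G (indicator {h. \<not> isolates_vertex n h})" by simp
  also have "\<dots> \<le> measure_pmf.expectation ?G (\<lambda>h. scarcity n h + stakes n p h)"
    using lost_le_scarcity_plus_stakes[OF p] scarcity_nonneg stakes_nonneg[OF p]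
    by (intro expectation_mono_pmf[OF fin]) (auto simp: indicator_def)
  also have "\<dots> = measure_pmf.expectation ?G (scarcity n) + measure_pmf.expectation ?G (stakes n p)"
    using fin by (intro Bochner_Integration.integral_add integrable_measure_pmf_finite)
  also have "\<dots> \<le> (1 + (2 * real m + 1) * p) ^ R * scarcity n [] + (1 - p * ?q / 2) ^ R * stakes n p []"
    using sc st by (rule add_mono)
  also have "scarcity n [] = 1 / (real n + 1)" by (simp add: scarcity_def isolated_Nil)
  also have "(1 - p * ?q / 2) ^ R * stakes n p [] \<le> (1 - p * ?q / 2) ^ R * 2"
  proof (rule mult_left_mono)
    show "stakes n p [] \<le> 2" using stakes_le[OF p, of n "[]"] p
      by (meson diff_ge_0_iff_ge diff_le_eq le_add_same_cancel1 order_trans zero_le_power)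
  qed (use pq in simp)
  finally show ?thesis by simp
qed

section \<open>Explicit estimates and the limit\<close>

lemma real_choose_two: "real (n choose 2) = real n * (real n - 1) / 2"
proof -
  have "real (n choose 2) = real (n * (n - 1)) / real 2"
    unfolding choose_two by (rule real_of_nat_div) (cases n, auto)
  thus ?thesis by (cases n) (auto simp: algebra_simps)
qed

lemma exp_le_one_minus_power:
  fixes p :: real
  assumes "p < 1"
  shows "exp (- (real k * p / (1 - p))) \<le> (1 - p) ^ k"
proof -
  have "1 / (1 - p) = 1 + p / (1 - p)" using assms by (simp add: field_simps)
  also have "\<dots> \<le> exp (p / (1 - p))" by (rule exp_ge_add_one_self)
  finally have "exp (- (p / (1 - p))) \<le> 1 - p"
    using assms by (simp add: exp_minus field_simps)
  hence "exp (- (p / (1 - p))) ^ k \<le> (1 - p) ^ k" by (intro power_mono) auto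
  thus ?thesis by (simp add: exp_of_nat_mult[symmetric])
qed

text \<open>Here \<open>L = ln (ln n)\<close>, \<open>p\<close> dominates the probability \<open>\<approx> 2 m / n\<close> that a round
  touches a given vertex, and \<open>B\<close> is the number of rounds analysed, short enough for
  \<open>(1 + (2 m + 1) p) ^ B\<close> to stay below \<open>sqrt n\<close>.\<close>

lemma prob_target_strategy_fails_le_explicit:
  fixes n m :: nat and e :: real
  defines "L \<equiv> ln (ln (real n))"
  defines "B \<equiv> real n * ln (real n) / (16 * L\<^sup>2)"
  defines "p \<equiv> 2 * (1 + e) * ((1/2 - e) * L) / real n"
  assumes e: "0 < e" "e \<le> 1/4" and n: "1 < n" and L: "1 \<le> L"
    and m: "real m \<le> (1/2 - e) * L"
    and p: "p \<le> 2 * e\<^sup>2 / (1 - e)" and p1: "p < 1"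
    and r: "(L + 1) * B \<le> e / (1 + e) * (real n * (real n - 1) / 2)"
  shows "measure_pmf.prob (random_maker_game n m (target_strategy n)) {h. \<not> isolates_vertex n h}
    \<le> exp (ln (real n) / 2) / (real n + 1)
      + 2 * exp (- (L / (4 * real n) * exp (- ((1 - e) * L)) * (B - 1)))"
proof -
  \<comment> \<open>\<open>p\<close> is built from this upper bound for \<open>m\<close>, not from
    \<open>m\<close> itself, so that it stays of order \<open>L / n\<close> even when
    \<open>m\<close> is small. The decay of \<open>stakes\<close> needs this.\<close>
  define \<mu> where "\<mu> = (1/2 - e) * L"
  define R where "R = nat \<lfloor>B\<rfloor>"
  define q where "q = (1 - p) ^ (n - 1)"
  have mu: "L / 4 \<le> \<mu>" "\<mu> \<le> L / 2" "0 \<le> \<mu>"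
  proof -
    show "L / 4 \<le> \<mu>" unfolding \<mu>_def using mult_right_mono[of "1/4" "1/2 - e" L] e L by simp
    show "\<mu> \<le> L / 2" unfolding \<mu>_def using mult_right_mono[of "1/2 - e" "1/2" L] e L by simp
    show "0 \<le> \<mu>" unfolding \<mu>_def using e L by simp
  qed
  have m': "real m \<le> \<mu>" unfolding \<mu>_def by (rule m)
  have pe: "p = 2 * (1 + e) * \<mu> / real n" unfolding p_def \<mu>_def ..
  have p0: "0 \<le> p" unfolding pe using e mu by simp
  have ln0: "0 \<le> ln (real n)" using n by simp
  have B0: "0 \<le> B" unfolding B_def using ln0 by simp
  have R: "real R \<le> B" "B - 1 \<le> real R" unfolding R_def using B0 by linarith+
  have n0: "real n > 1" using n by simp
  have nn: "real n * (real n - 1) / 2 > 0" using n0 by simp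
  \<comment> \<open>At least the fraction \<open>1 / (1 + e)\<close> of the board stays free, which
    the factor \<open>1 + e\<close> in \<open>p\<close> compensates.\<close>
  have mR: "real ((m + 1) * R) \<le> e / (1 + e) * (real n * (real n - 1) / 2)"
  proof -
    have "real ((m + 1) * R) = (real m + 1) * real R" by (simp add: algebra_simps)
    also have "\<dots> \<le> (L + 1) * B"
      using R m' mu L by (intro mult_mono) auto
    finally show ?thesis using r by linarith
  qed
  have "e / (1 + e) < 1" using e by simp
  hence "e / (1 + e) * (real n * (real n - 1) / 2) < 1 * (real n * (real n - 1) / 2)"
    using nn by (rule mult_strict_right_mono)
  hence "real ((m + 1) * R) < real (n choose 2)" using mR unfolding real_choose_two by linarith
  hence mR': "(m + 1) * R < n choose 2" by (simp only: of_nat_less_iff)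
  have hazard: "real (n - 1) * real m \<le> p * (real (n choose 2) - real ((m + 1) * R))"
  proof -
    have "real (n - 1) * real m \<le> (real n - 1) * \<mu>"
      using n m' by (intro mult_mono) auto
    also have "\<dots> = p * (real n * (real n - 1) / 2 - e / (1 + e) * (real n * (real n - 1) / 2))"
    proof -
      have "real n * (real n - 1) / 2 - e / (1 + e) * (real n * (real n - 1) / 2)
        = real n * (real n - 1) / (2 * (1 + e))" using e by (simp add: field_simps)
      thus ?thesis unfolding pe using n0 e by simp
    qed
    also have "\<dots> \<le> p * (real (n choose 2) - real ((m + 1) * R))"
      using mR p0 by (intro mult_left_mono) (auto simp: real_choose_two)
    finally show ?thesis .
  qed
  have T1: "(1 + (2 * real m + 1) * p) ^ R \<le> exp (ln (real n) / 2)"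
  proof -
    have "(1 + (2 * real m + 1) * p) ^ R \<le> exp ((2 * real m + 1) * p) ^ R"
      using p0 by (intro power_mono exp_ge_add_one_self) auto
    also have "\<dots> = exp ((2 * real m + 1) * p * real R)"
      by (simp add: exp_of_nat_mult[symmetric] mult.commute)
    also have "(2 * real m + 1) * p * real R \<le> (2 * L) * (5 / 4 * L / real n) * B"
    proof (intro mult_mono R)
      show "2 * real m + 1 \<le> 2 * L" using m' mu L by simp
      have "2 * (1 + e) * \<mu> \<le> 5 / 2 * (L / 2)" using e mu by (intro mult_mono) auto
      thus "p \<le> 5 / 4 * L / real n" unfolding pe using n0 by (intro divide_right_mono) auto
    qed (use p0 L in auto)
    also have "\<dots> = 10 / 64 * ln (real n)"
      unfolding B_def using L n0 by (simp add: field_simps power2_eq_square)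
    also have "\<dots> \<le> ln (real n) / 2" using ln0 by simp
    finally show ?thesis by simp
  qed
  \<comment> \<open>Here \<open>n * p = (1 + e) * (1 - 2 * e) * L\<close>, which falls short of
    \<open>(1 - e) * L\<close> by \<open>2 * e\<^sup>2 * L\<close>. This slack absorbs the division
    by \<open>1 - p\<close>.\<close>
  have "exp (- ((1 - e) * L)) \<le> exp (- (real (n - 1) * p / (1 - p)))"
  proof -
    have "real (n - 1) * p \<le> real n * p" using p0 by (intro mult_right_mono) auto
    also have "\<dots> = (1 - e - 2 * e\<^sup>2) * L"
      unfolding p_def using n0 by (simp add: field_simps power2_eq_square)
    also have "\<dots> \<le> ((1 - e) * (1 - p)) * L"
    proof (rule mult_right_mono)
      have "p * (1 - e) \<le> 2 * e\<^sup>2" using p e by (simp add: pos_le_divide_eq)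
      thus "1 - e - 2 * e\<^sup>2 \<le> (1 - e) * (1 - p)" by (simp add: algebra_simps)
    qed (use L in simp)
    finally show ?thesis using p1 by (simp add: pos_divide_le_eq mult_ac)
  qed
  also have "\<dots> \<le> q" unfolding q_def by (rule exp_le_one_minus_power[OF p1])
  finally have q: "exp (- ((1 - e) * L)) \<le> q" .
  have q01: "0 \<le> q" "q \<le> 1" unfolding q_def using p0 p1 by (auto intro: power_le_one)
  have T2: "(1 - p * q / 2) ^ R \<le> exp (- (L / (4 * real n) * exp (- ((1 - e) * L)) * (B - 1)))"
  proof -
    have "p * q \<le> 1" using p0 p1 q01 by (intro mult_le_one) auto
    hence "(1 - p * q / 2) ^ R \<le> exp (- (p * q / 2)) ^ R"
      using exp_ge_add_one_self[of "- (p * q / 2)"] by (intro power_mono) auto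
    also have "\<dots> = exp (- (p / 2 * q * real R))"
      by (simp add: exp_of_nat_mult[symmetric] mult_ac)
    also have "L / (4 * real n) * exp (- ((1 - e) * L)) * (B - 1) \<le> p / 2 * q * real R"
    proof -
      \<comment> \<open>The bound \<open>L / 4 \<le> \<mu>\<close> rests on
        \<open>e \<le> 1/4\<close>; the \<open>B - 1\<close> in the claim allows for rounding
        \<open>B\<close> down to \<open>R\<close>.\<close>
      have "L / 4 \<le> (1 + e) * \<mu>" using mult_right_mono[of 1 "1 + e" \<mu>] mu e by simp
      hence "L / 4 / real n \<le> (1 + e) * \<mu> / real n" by (intro divide_right_mono) auto
      moreover have "p / 2 = (1 + e) * \<mu> / real n" unfolding pe using n0 by (simp add: field_simps)
      ultimately have "L / (4 * real n) \<le> p / 2" by simp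
      hence a: "L / (4 * real n) * exp (- ((1 - e) * L)) \<le> p / 2 * q"
        using q p0 by (intro mult_mono) auto
      have "L / (4 * real n) * exp (- ((1 - e) * L)) * (B - 1)
          \<le> L / (4 * real n) * exp (- ((1 - e) * L)) * real R"
        using R L by (intro mult_left_mono) auto
      also have "\<dots> \<le> p / 2 * q * real R" using a by (rule mult_right_mono) simp
      finally show ?thesis .
    qed
    hence "exp (- (p / 2 * q * real R)) \<le> exp (- (L / (4 * real n) * exp (- ((1 - e) * L)) * (B - 1)))"
      by simp
    finally show ?thesis .
  qed
  have "measure_pmf.prob (random_maker_game n m (target_strategy n)) {h. \<not> isolates_vertex n h}
    \<le> (1 + (2 * real m + 1) * p) ^ R / (real n + 1) + 2 * (1 - p * q / 2) ^ R"
    unfolding q_def by (rule prob_target_strategy_fails_le) (use p0 p1 mR' hazard in auto)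
  also have "\<dots> \<le> exp (ln (real n) / 2) / (real n + 1)
      + 2 * exp (- (L / (4 * real n) * exp (- ((1 - e) * L)) * (B - 1)))"
    using T1 T2 by (intro add_mono divide_right_mono mult_left_mono) auto
  finally show ?thesis .
qed

theorem theorem1p4:
  fixes \<epsilon> :: real and m :: "nat \<Rightarrow> nat"
  assumes "\<epsilon> > 0"
    and "eventually (\<lambda>n. real (m n) \<le> (1/2 - \<epsilon>) * ln (ln (real n))) sequentially"
  shows "\<exists>S. (\<forall>n. breaker_strategy n (S n)) \<and>
           (\<lambda>n. measure_pmf.prob (random_maker_game n (m n) (S n)) {h. isolates_vertex n h})
             \<longlonglongrightarrow> 1"
proof (intro exI conjI allI)
  show "breaker_strategy n (target_strategy n)" for n by (rule breaker_strategy_target_strategy)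
  \<comment> \<open>Lowering \<open>\<epsilon>\<close> only relaxes the bound on \<open>m\<close>
    once \<open>ln (ln n)\<close> is nonnegative.\<close>
  define e where "e = min \<epsilon> (1/4)"
  have e: "0 < e" "e \<le> 1/4" "e \<le> \<epsilon>" using assms(1) by (auto simp: e_def)
  let ?L = "\<lambda>n. ln (ln (real n))"
  let ?B = "\<lambda>n. real n * ln (real n) / (16 * (?L n)\<^sup>2)"
  let ?p = "\<lambda>n. 2 * (1 + e) * ((1/2 - e) * ?L n) / real n"
  let ?b = "\<lambda>n. exp (ln (real n) / 2) / (real n + 1)
      + 2 * exp (- (?L n / (4 * real n) * exp (- ((1 - e) * ?L n)) * (?B n - 1)))"
  let ?fail = "\<lambda>n. measure_pmf.prob (random_maker_game n (m n) (target_strategy n))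
      {h. \<not> isolates_vertex n h}"
  have L1: "eventually (\<lambda>n. 1 \<le> ?L n) sequentially" by real_asymp
  have p_lim: "?p \<longlonglongrightarrow> 0"
  proof -
    have "(\<lambda>n. (2 * (1 + e) * (1/2 - e)) * (?L n / real n)) \<longlonglongrightarrow> (2 * (1 + e) * (1/2 - e)) * 0"
      by (intro tendsto_mult_left) real_asymp
    thus ?thesis by (simp add: mult_ac)
  qed
  have r_lim: "(\<lambda>n. (?L n + 1) * ?B n / (real n * (real n - 1) / 2)) \<longlonglongrightarrow> 0"
    by real_asymp
  have bounds: "0 < 2 * e\<^sup>2 / (1 - e)" "0 < e / (1 + e)" using e by simp_all
  have "eventually (\<lambda>n. ?fail n \<le> ?b n) sequentially"
    using assms(2) L1 eventually_gt_at_top[of "1::nat"]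
      order_tendstoD(2)[OF p_lim bounds(1)] order_tendstoD(2)[OF p_lim zero_less_one]
      order_tendstoD(2)[OF r_lim bounds(2)]
  proof eventually_elim
    case (elim n)
    have "(1/2 - \<epsilon>) * ?L n \<le> (1/2 - e) * ?L n" using e elim(2) by (intro mult_right_mono) auto
    hence m: "real (m n) \<le> (1/2 - e) * ?L n" using elim(1) by linarith
    have "real n * (real n - 1) / 2 > 0" using elim(3) by simp
    hence "(?L n + 1) * ?B n \<le> e / (1 + e) * (real n * (real n - 1) / 2)"
      using elim(6) by (simp only: pos_divide_less_eq)
    thus ?case
      using e elim m by (intro prob_target_strategy_fails_le_explicit) auto
  qed
  moreover have "?b \<longlonglongrightarrow> 0"
  proof -
    have "filterlim (\<lambda>n. ?L n / (4 * real n) * exp (- ((1 - e) * ?L n)) * (?B n - 1)) at_top sequentially"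
    proof (rule filterlim_at_top_mono)
      \<comment> \<open>The first term is \<open>(ln n)\<close> to the power \<open>e\<close>,
        divided by \<open>64 * ln (ln n)\<close>. The margin \<open>e\<close> below
        \<open>1/2\<close> is what makes it diverge.\<close>
      show "filterlim (\<lambda>n. exp (e * ?L n) / (64 * ?L n) - ?L n / (4 * real n)) at_top sequentially"
        using e(1) by real_asymp
      show "eventually (\<lambda>n. exp (e * ?L n) / (64 * ?L n) - ?L n / (4 * real n)
          \<le> ?L n / (4 * real n) * exp (- ((1 - e) * ?L n)) * (?B n - 1)) sequentially"
        using L1 eventually_gt_at_top[of "1::nat"]
      proof eventually_elim
        case (elim n)
        define a where "a = exp (- ((1 - e) * ?L n))"
        have lnn: "0 < ln (real n)" using elim(2) by simp
        \<comment> \<open>The factor \<open>ln n\<close> of \<open>?B n\<close> equals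
          \<open>exp (?L n)\<close> and turns the decay rate \<open>1 - e\<close> into the growth
          rate \<open>e\<close>.\<close>
        have "a * ln (real n) = a * exp (?L n)" using lnn by simp
        also have "\<dots> = exp (e * ?L n)" unfolding a_def exp_add[symmetric] by (simp add: algebra_simps)
        finally have "exp (e * ?L n) / (64 * ?L n) = ?L n / (4 * real n) * a * ?B n"
          using elim by (simp add: field_simps power2_eq_square)
        moreover have "a \<le> 1" unfolding a_def using e elim(1) by simp
        hence "?L n / (4 * real n) * a \<le> ?L n / (4 * real n)"
          using elim(1) by (intro mult_left_le) auto
        ultimately show ?case unfolding a_def[symmetric] right_diff_distrib by simp
      qed
    qed
    hence win: "(\<lambda>n. exp (- (?L n / (4 * real n) * exp (- ((1 - e) * ?L n)) * (?B n - 1)))) \<longlonglongrightarrow> 0"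
      by (intro filterlim_compose[OF exp_at_bot] filterlim_compose[OF filterlim_uminus_at_bot_at_top])
    have "(\<lambda>n. exp (ln (real n) / 2) / (real n + 1)) \<longlonglongrightarrow> 0" by real_asymp
    from tendsto_add[OF this tendsto_mult_left[OF win, of 2]] show ?thesis by simp
  qed
  ultimately have "?fail \<longlonglongrightarrow> 0"
    by (intro tendsto_sandwich[of "\<lambda>_. 0" ?fail sequentially ?b]) auto
  hence "(\<lambda>n. 1 - ?fail n) \<longlonglongrightarrow> 1 - 0" by (intro tendsto_intros)
  moreover have "1 - ?fail n
      = measure_pmf.prob (random_maker_game n (m n) (target_strategy n)) {h. isolates_vertex n h}" for n
    using measure_pmf.prob_compl[of "{h. isolates_vertex n h}"
        "random_maker_game n (m n) (target_strategy n)"]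
    by (simp add: Compl_eq_Diff_UNIV[symmetric] Collect_neg_eq)
  ultimately show "(\<lambda>n. measure_pmf.prob (random_maker_game n (m n) (target_strategy n))
      {h. isolates_vertex n h}) \<longlonglongrightarrow> 1" by simp
qed

end
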